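(* Let $\gamma$ denote Euler's constant, $\gamma=\lim_{n\to\infty}\left(\sum_{j=1}^{n}\frac{1}{j}-\log n\right)$. Suppose that $x>0$ and $w>0$ are real numbers. Then \[ \gamma=\frac{w}{2}-\log(x)-w\sum_{k=0}^{\infty}e^{-x e^{w k}}+w\sum_{k=1}^{\infty}\frac{(-1)^{k+1}}{k!}\frac{x^k}{e^{w k}-1}+\sum_{\substack{k=-\infty\\k\neq 0}}^{\infty}\Gamma\left(\frac{2\pi i k}{w}\right)x^{-2\pi i k/w}, \] where $\Gamma$ is the Euler Gamma function, $\log$ is the natural logarithm, and $x^{-2\pi i k/w}=e^{-(2\pi i k/w)\log x}$. *)

theory Defs
  imports "HOL-Complex_Analysis.Complex_Analysis"
begin

end

theory Submission
  imports Defs "HOL-Real_Asymp.Real_Asymp"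
begin

text \<open>
  Write \<open>F v = exp (- x * exp (w * v))\<close>. Expanding the exponential turns the second series of the
  theorem into \<open>\<Sum>k\<ge>1. 1 - F (- k)\<close>, so the two real series combine to \<open>G 0\<close>, where
  \<open>G v = (\<Sum>k\<ge>0. F (v + k)) + (\<Sum>k\<ge>1. F (v - k) - 1)\<close>. Since \<open>G (v + 1) = G v - 1\<close>, the function
  \<open>P v = v + ln x / w + G v\<close> has period 1, and the theorem is its Fourier series at 0. The
  Fourier integrals over one period unfold to integrals over the real line; integration by parts and the
  substitution \<open>u = x * exp (w * v)\<close> turn them into Gamma integrals at \<open>1 + 2 \<pi> i n / w\<close>,
  and for \<open>n = 0\<close> into \<open>\<integral> ln u * exp (- u) = - \<gamma>\<close>.
\<close>

text \<open>The obstacle is that \<open>F\<close> tends to 1 at minus infinity. Its left translates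
  are summable only after subtracting 1, and the Fourier integrals of \<open>F\<close> itself would
  lead to Gamma integrals at the purely imaginary points 2 \<pi> i n / w, which do not converge at u
  = 0. Integration by parts cures both: it replaces \<open>F\<close> by \<open>f\<close>, minus its
  derivative, which decays at both ends and does not see the constant, and it raises the Gamma
  argument by 1; the functional equation lowers it again. The price is a boundary value at -1/2,
  where the two normalisations meet; for n \<noteq> 0 it is cancelled by the coefficient of the
  linear term of \<open>P\<close>. For n = 0 the primitive of 1 is v = (ln u - ln x) / w, hence the
  logarithm in that integral. Fourier convergence at 0 is obtained for symmetric partial sums, while
  the theorem asserts an unordered sum over the nonzero integers. The bridge is absolute
  summability, from a quadratic bound on Gamma along the imaginary axis.\<close>

section \<open>Pointwise convergence of Fourier series on [-1/2, 1/2]\<close>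

lemma has_vector_derivative_cis_mult:
  "((\<lambda>v. cis (s * v)) has_vector_derivative \<i> * of_real s * cis (s * v)) (at v within A)"
proof -
  have "((\<lambda>z. exp (\<i> * of_real s * z)) has_field_derivative \<i> * of_real s * exp (\<i> * of_real s * of_real v))
          (at (of_real v))"
    by (auto intro!: derivative_eq_intros)
  from has_vector_derivative_real_field[OF this] show ?thesis
    by (simp add: cis_conv_exp mult.assoc)
qed

lemma has_vector_derivative_cis_primitive:
  assumes "s \<noteq> 0"
  shows "((\<lambda>v. cis (s * v) / (\<i> * of_real s)) has_vector_derivative cis (s * v)) (at v within A)"
  using has_vector_derivative_mult_left[OF has_vector_derivative_cis_mult[of s v A], of "1 / (\<i> * of_real s)"] assms
  by simp

lemma cis_half_period: "cis (2 * pi * of_int n * (1/2)) = cis (2 * pi * of_int n * (-1/2))"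
proof -
  have "cis (2 * pi * of_int n * (1/2)) = cis (2 * pi * of_int n * (-1/2)) * cis (2 * pi * of_int n)"
    unfolding cis_mult by (simp add: field_simps)
  thus ?thesis by (simp add: cis_multiple_2pi)
qed

lemma has_vector_derivative_at_0_tendsto:
  fixes f :: "real \<Rightarrow> 'a::real_normed_vector"
  assumes "(f has_vector_derivative D) (at 0)"
  shows "((\<lambda>v. (f v - f 0) /\<^sub>R v) \<longlongrightarrow> D) (at 0)"
proof -
  have "((\<lambda>h. norm (f (0 + h) - f 0 - h *\<^sub>R D) / norm h) \<longlongrightarrow> 0) (at 0)"
    using assms by (simp add: has_vector_derivative_def has_derivative_at)
  moreover have "eventually (\<lambda>h. norm (f (0 + h) - f 0 - h *\<^sub>R D) / norm h = norm ((f h - f 0) /\<^sub>R h - D)) (at 0)"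
  proof (rule eventually_mono[OF eventually_neq_at_within])
    fix h :: real assume h: "h \<noteq> 0"
    have "(f h - f 0) /\<^sub>R h - D = (f (0 + h) - f 0 - h *\<^sub>R D) /\<^sub>R h"
      using h by (simp add: scaleR_diff_right)
    thus "norm (f (0 + h) - f 0 - h *\<^sub>R D) / norm h = norm ((f h - f 0) /\<^sub>R h - D)"
      by (simp add: divide_inverse mult.commute)
  qed
  ultimately have "((\<lambda>h. norm ((f h - f 0) /\<^sub>R h - D)) \<longlongrightarrow> 0) (at 0)"
    by (rule Lim_transform_eventually)
  thus ?thesis by (simp add: tendsto_norm_zero_iff LIM_zero_iff)
qed

text \<open>Riemann--Lebesgue: a uniform polynomial approximation has a bounded derivative, so one
  integration by parts makes its integral O(1 / |s|), while the approximation error costs at most e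
  / 2 for every s. The filter \<open>at_infinity\<close> covers both signs of s, hence both ends of
  the telescoped Fourier sum.\<close>

lemma tendsto_integral_cis_at_infinity:
  fixes g :: "real \<Rightarrow> complex"
  assumes g: "continuous_on {a..b} g"
  shows "((\<lambda>s. integral {a..b} (\<lambda>v. g v * cis (s * v))) \<longlongrightarrow> 0) at_infinity"
proof (cases "a \<le> b")
  case True
  show ?thesis
  proof (rule tendstoI)
    fix e :: real assume e: "e > 0"
    \<comment> \<open>The +1 keeps the denominator positive when a = b; what is used is \<delta> (b
      - a) \<le> e / 2.\<close>
    define \<delta> where "\<delta> = e / (2 * (b - a + 1))"
    have \<delta>: "\<delta> > 0" using e True by (auto simp: \<delta>_def)
    obtain p where p: "polynomial_function p" "\<And>v. v \<in> {a..b} \<Longrightarrow> norm (g v - p v) < \<delta>"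
      using Stone_Weierstrass_polynomial_function[OF compact_Icc g \<delta>] by auto
    obtain p' where p': "polynomial_function p'" "\<And>v. (p has_vector_derivative p' v) (at v)"
      using has_vector_derivative_polynomial_function[OF p(1)] by blast
    have cp: "continuous_on A p" and cp': "continuous_on A p'" for A
      using p(1) p'(1) by (auto intro: continuous_on_polymonial_function)
    have "bounded (p' ` {a..b})"
      by (intro compact_imp_bounded compact_continuous_image cp') auto
    then obtain B where B: "\<And>v. v \<in> {a..b} \<Longrightarrow> norm (p' v) \<le> B" "B > 0"
      unfolding bounded_pos by (metis imageI)
    define C where "C = norm (p a) + norm (p b) + B * (b - a)"
    have C: "C \<ge> 0" using B True by (auto simp: C_def)
    have main: "norm (integral {a..b} (\<lambda>v. g v * cis (s * v))) \<le> e / 2 + C / \<bar>s\<bar>" if s: "s \<noteq> 0" for s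
    proof -
      have 1: "norm (integral {a..b} (\<lambda>v. (g v - p v) * cis (s * v))) \<le> \<delta> * (b - a)"
        by (rule integral_bound) (use True p(2) in \<open>auto intro!: continuous_intros g cp simp: norm_mult less_imp_le\<close>)
      have 2: "norm (integral {a..b} (\<lambda>v. p' v * (cis (s * v) / (\<i> * of_real s)))) \<le> B / \<bar>s\<bar> * (b - a)"
        by (rule integral_bound)
          (use True B s in \<open>auto intro!: continuous_intros cp' divide_right_mono simp: norm_mult norm_divide\<close>)
      have int_p': "(\<lambda>v. p' v * (cis (s * v) / (\<i> * of_real s))) integrable_on {a..b}"
        by (intro integrable_continuous_interval continuous_intros cp') (use s in auto)
      have "((\<lambda>v. p v * cis (s * v)) has_integral
              (p b * (cis (s * b) / (\<i> * of_real s)) - p a * (cis (s * a) / (\<i> * of_real s))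
                - integral {a..b} (\<lambda>v. p' v * (cis (s * v) / (\<i> * of_real s))))) {a..b}"
      \<comment> \<open>Flipping the bilinear product lets \<open>cis\<close> be the factor that is
        integrated and still keeps \<open>p\<close> on the left.\<close>
      proof (rule integration_by_parts[OF bounded_bilinear.flip[OF bounded_bilinear_mult] True,
            where g = p and g' = p' and f = "\<lambda>v. cis (s * v) / (\<i> * of_real s)"])
        show "((\<lambda>v. p' v * (cis (s * v) / (\<i> * of_real s))) has_integral
          p b * (cis (s * b) / (\<i> * complex_of_real s)) - p a * (cis (s * a) / (\<i> * complex_of_real s)) -
         (p b * (cis (s * b) / (\<i> * of_real s)) - p a * (cis (s * a) / (\<i> * of_real s))
                - integral {a..b} (\<lambda>v. p' v * (cis (s * v) / (\<i> * of_real s))))) {a..b}"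
          using integrable_integral[OF int_p'] by simp
        show "((\<lambda>v. cis (s * v) / (\<i> * complex_of_real s)) has_vector_derivative cis (s * v)) (at v)" for v
          by (rule has_vector_derivative_cis_primitive[OF s])
      qed (use s p' in \<open>auto intro!: continuous_intros cp\<close>)
      hence "integral {a..b} (\<lambda>v. p v * cis (s * v)) =
          p b * (cis (s * b) / (\<i> * of_real s)) - p a * (cis (s * a) / (\<i> * of_real s))
                - integral {a..b} (\<lambda>v. p' v * (cis (s * v) / (\<i> * of_real s)))"
        by (rule integral_unique)
      also have "norm \<dots> \<le> norm (p b * (cis (s * b) / (\<i> * of_real s))) + norm (p a * (cis (s * a) / (\<i> * of_real s)))
                + norm (integral {a..b} (\<lambda>v. p' v * (cis (s * v) / (\<i> * of_real s))))"
        by (meson add_right_mono norm_triangle_ineq4 order_trans)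
      also have "\<dots> \<le> norm (p b) / \<bar>s\<bar> + norm (p a) / \<bar>s\<bar> + B / \<bar>s\<bar> * (b - a)"
        using 2 by (simp add: norm_mult norm_divide)
      also have "\<dots> = C / \<bar>s\<bar>" by (simp add: C_def add_divide_distrib)
      finally have 3: "norm (integral {a..b} (\<lambda>v. p v * cis (s * v))) \<le> C / \<bar>s\<bar>" .
      have "integral {a..b} (\<lambda>v. g v * cis (s * v)) =
          integral {a..b} (\<lambda>v. (g v - p v) * cis (s * v)) + integral {a..b} (\<lambda>v. p v * cis (s * v))"
        by (subst integral_add [symmetric])
           (auto intro!: integrable_continuous_interval continuous_intros g cp simp: algebra_simps)
      also have "norm \<dots> \<le> \<delta> * (b - a) + C / \<bar>s\<bar>"
        using norm_triangle_le[OF add_mono[OF 1 3]] .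
      also have "\<delta> * (b - a) \<le> e / 2" using True e by (simp add: \<delta>_def field_simps)
      finally show ?thesis by simp
    qed
    have "eventually (\<lambda>s::real. norm s \<ge> 2 * C / e + 1) at_infinity"
      unfolding eventually_at_infinity by blast
    thus "eventually (\<lambda>s. dist (integral {a..b} (\<lambda>v. g v * cis (s * v))) 0 < e) at_infinity"
    proof eventually_elim
      case (elim s)
      have "0 \<le> 2 * C / e" using C e by simp
      hence s: "\<bar>s\<bar> > 0" "\<bar>s\<bar> > 2 * C / e" using elim by auto
      have "C / \<bar>s\<bar> < e / 2" using s e by (simp add: field_simps)
      moreover have "norm (integral {a..b} (\<lambda>v. g v * cis (s * v))) \<le> e / 2 + C / \<bar>s\<bar>"
        using main[of s] s by simp
      ultimately show ?case unfolding dist_norm diff_zero by linarith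
    qed
  qed
qed auto

lemma integral_cis_period:
  "integral {-1/2..1/2} (\<lambda>v::real. cis (2 * pi * of_int n * v)) = (if n = 0 then 1 else 0)"
proof (cases "n = 0")
  case False
  define s where "s = 2 * pi * of_int n"
  have s: "s \<noteq> 0" using False by (simp add: s_def)
  have "((\<lambda>v. cis (s * v)) has_integral (cis (s * (1/2)) / (\<i> * of_real s) - cis (s * (-1/2)) / (\<i> * of_real s))) {-1/2..1/2}"
    by (intro fundamental_theorem_of_calculus has_vector_derivative_cis_primitive s) auto
  moreover have "cis (s * (1/2)) = cis (s * (-1/2))"
    unfolding s_def by (rule cis_half_period)
  ultimately show ?thesis using False unfolding s_def by (simp add: has_integral_iff)
qed simp

text \<open>Dividing \<open>f - f 0\<close> by \<open>cis (2 * pi * v) - 1\<close> makes the partial sums telescope (Chernoff),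
  which leaves two coefficients that vanish by the Riemann--Lebesgue lemma.\<close>
lemma fourier_symmetric_partial_sums_tendsto:
  fixes f :: "real \<Rightarrow> complex"
  assumes cont: "continuous_on {-1/2..1/2} f"
    and deriv: "(f has_vector_derivative D) (at 0)"
  shows "(\<lambda>N. \<Sum>n = - int N..int N. integral {-1/2..1/2} (\<lambda>v. f v * cis (2 * pi * of_int n * v)))
           \<longlonglongrightarrow> f 0"
proof -
  \<comment> \<open>The removable singularity at 0 is filled with the quotient of the derivatives of
    numerator and denominator.\<close>
  define g where "g = (\<lambda>v. if v = 0 then D / (2 * pi * \<i>) else (f v - f 0) / (cis (2 * pi * v) - 1))"
  \<comment> \<open>The denominator vanishes only at integers, and 0 is the only integer in the
    closed interval.\<close>
  have ne: "cis (2 * pi * v) \<noteq> 1" if "v \<in> {-1/2..1/2}" "v \<noteq> 0" for v :: real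
  proof
    assume "cis (2 * pi * v) = 1"
    hence "cos (2 * pi * v) = 1" by (simp add: complex_eq_iff)
    then obtain m :: int where m: "2 * pi * v = of_int m * 2 * pi" by (auto simp: cos_one_2pi_int)
    hence "v = of_int m" by simp
    with that show False by (auto simp: abs_if)
  qed
  have at0: "(g \<longlongrightarrow> g 0) (at 0)"
  proof -
    have 1: "((\<lambda>v. (f v - f 0) /\<^sub>R v) \<longlongrightarrow> D) (at 0)"
      by (rule has_vector_derivative_at_0_tendsto[OF deriv])
    have 2: "((\<lambda>v. (cis (2 * pi * v) - 1) /\<^sub>R v) \<longlongrightarrow> 2 * pi * \<i>) (at 0)"
      using has_vector_derivative_at_0_tendsto[OF has_vector_derivative_cis_mult[of "2 * pi" 0 UNIV]]
      by (simp add: mult.commute)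
    have "((\<lambda>v. ((f v - f 0) /\<^sub>R v) / ((cis (2 * pi * v) - 1) /\<^sub>R v)) \<longlongrightarrow> D / (2 * pi * \<i>)) (at 0)"
      by (intro tendsto_divide 1 2) simp
    moreover have "eventually (\<lambda>v. ((f v - f 0) /\<^sub>R v) / ((cis (2 * pi * v) - 1) /\<^sub>R v) = g v) (at 0)"
      by (intro eventually_mono[OF eventually_neq_at_within]) (auto simp: g_def scaleR_conv_of_real divide_simps)
    ultimately show ?thesis by (auto simp: g_def elim: Lim_transform_eventually)
  qed
  have contg: "continuous_on {-1/2..1/2} g"
    unfolding continuous_on_eq_continuous_within
  proof
    fix v :: real assume v: "v \<in> {-1/2..1/2}"
    show "continuous (at v within {-1/2..1/2}) g"
    proof (cases "v = 0")
      case True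
      thus ?thesis using at0 by (auto simp: continuous_within intro: tendsto_within_subset)
    next
      case False
      have "continuous (at v within {-1/2..1/2}) (\<lambda>v. (f v - f 0) / (cis (2 * pi * v) - 1))"
        using cont v ne[OF v False] unfolding continuous_on_eq_continuous_within
        by (intro continuous_intros has_vector_derivative_continuous[OF has_vector_derivative_cis_mult]) auto
      moreover have "eventually (\<lambda>v. (f v - f 0) / (cis (2 * pi * v) - 1) = g v) (at v within {-1/2..1/2})"
        using False by (intro eventually_mono[OF eventually_neq_at_within[of 0]]) (auto simp: g_def)
      ultimately show ?thesis using False unfolding continuous_within
        by (auto simp: g_def elim: Lim_transform_eventually)
    qed
  qed
  define d where "d = (\<lambda>n::int. integral {-1/2..1/2} (\<lambda>v. g v * cis (2 * pi * of_int n * v)))"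
  have int_g: "(\<lambda>v. g v * cis (2 * pi * of_int n * v)) integrable_on {-1/2..1/2}" for n
    by (intro integrable_continuous_interval continuous_intros contg)
  have cont_cis: "continuous_on A (\<lambda>v. cis (2 * pi * of_int n * v))" for A and n :: int
    by (intro continuous_intros)
  \<comment> \<open>Multiplication by cis (2 \<pi> v) raises the frequency by one, hence the
    difference of neighbouring \<open>d\<close>; the constant f 0 is orthogonal to all frequencies
    but 0.\<close>
  have coeff: "integral {-1/2..1/2} (\<lambda>v. f v * cis (2 * pi * of_int n * v)) =
      (d (n + 1) - d n) + (if n = 0 then f 0 else 0)" for n :: int
  proof -
    have "f v * cis (2 * pi * of_int n * v) = (g v * cis (2 * pi * of_int (n + 1) * v) - g v * cis (2 * pi * of_int n * v))
            + f 0 * cis (2 * pi * of_int n * v)" if "v \<in> {-1/2..1/2}" for v :: real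
    proof -
      have fv: "f v = f 0 + g v * (cis (2 * pi * v) - 1)"
        using ne[OF that] by (auto simp: g_def)
      have e1: "cis (2 * pi * of_int (n + 1) * v) = cis (2 * pi * of_int n * v) * cis (2 * pi * v)"
        by (simp add: cis_mult algebra_simps)
      show ?thesis unfolding e1 by (subst fv) (simp only: ring_distribs mult_ac, simp)
    qed
    hence "integral {-1/2..1/2} (\<lambda>v. f v * cis (2 * pi * of_int n * v)) =
       integral {-1/2..1/2} (\<lambda>v. (g v * cis (2 * pi * of_int (n + 1) * v) - g v * cis (2 * pi * of_int n * v))
            + f 0 * cis (2 * pi * of_int n * v))"
      by (intro integral_cong) auto
    also have "\<dots> = (d (n + 1) - d n) + f 0 * integral {-1/2..1/2} (\<lambda>v::real. cis (2 * pi * of_int n * v))"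
      unfolding d_def
      by (subst integral_add)
        (simp_all only: integral_diff[OF int_g int_g] integral_mult_right integrable_diff[OF int_g int_g]
          integrable_continuous_interval[OF continuous_on_mult_left[OF cont_cis]])
    finally show ?thesis unfolding integral_cis_period by simp
  qed
  have partial: "(\<Sum>n = - int N..int N. integral {-1/2..1/2} (\<lambda>v. f v * cis (2 * pi * of_int n * v)))
      = f 0 + d (int N + 1) - d (- int N)" for N
    unfolding coeff
  proof (induction N)
    case (Suc N)
    have *: "{- int (Suc N)..int (Suc N)} = insert (- int (Suc N)) (insert (int (Suc N)) {- int N..int N})" by auto
    show ?case unfolding * using Suc by (simp add: algebra_simps)
  qed simp
  have lim: "(\<lambda>N. d (h N)) \<longlonglongrightarrow> 0" if "filterlim (\<lambda>N. 2 * pi * of_int (h N) :: real) at_infinity sequentially" for h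
    using filterlim_compose[OF tendsto_integral_cis_at_infinity[OF contg] that] by (simp add: d_def)
  have "(\<lambda>N. d (int N + 1)) \<longlonglongrightarrow> 0"
    by (rule lim, rule filterlim_at_top_imp_at_infinity) real_asymp
  moreover have "(\<lambda>N. d (- int N)) \<longlonglongrightarrow> 0"
    by (rule lim, rule filterlim_at_bot_imp_at_infinity) real_asymp
  ultimately have "(\<lambda>N. f 0 + d (int N + 1) - d (- int N)) \<longlonglongrightarrow> f 0 + 0 - 0"
    by (intro tendsto_intros)
  thus ?thesis unfolding partial by simp
qed

section \<open>Gamma integrals: the logarithmic integral at 1 and decay on the imaginary
  axis\<close>

text \<open>Both pieces come from ln t \<le> t - 1, applied to u and to u powr (-1/2). The exponent
  -1/2 dominates the logarithm near 0 and is still integrable there.\<close>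

lemma abs_ln_le_powr:
  fixes u :: real
  assumes "u > 0"
  shows "\<bar>ln u\<bar> \<le> 2 * u powr (-1/2) + u"
proof -
  have "ln u \<le> u" using ln_le_minus_one[OF assms] by simp
  moreover have "- ln u \<le> 2 * u powr (-1/2)"
    using ln_le_minus_one[of "u powr (-1/2)"] assms by (simp add: ln_powr)
  moreover have "u powr (-1/2) \<ge> 0" by simp
  ultimately show ?thesis using assms by linarith
qed

lemma norm_exp_imaginary_minus_1_le: "norm (exp (\<i> * of_real a) - 1) \<le> \<bar>a\<bar>"
proof -
  have "norm (exp (\<i> * of_real a) - 1) = 2 * \<bar>sin (a / 2)\<bar>"
    by (rule dist_exp_i_1)
  also have "\<dots> \<le> \<bar>a\<bar>" using abs_sin_x_le_abs_x[of "a/2"] by simp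
  finally show ?thesis .
qed

text \<open>The two summands are Gamma integrals at 1/2 and at 2.\<close>

lemma ln_exp_majorant_integrable:
  "(\<lambda>u::real. (2 * u powr (-1/2) + u) / exp u) integrable_on {0<..}"
proof -
  have *: "(\<lambda>t::real. t powr (y - 1) / exp t) integrable_on {0<..}" if "y > 0" for y
  proof -
    have "(\<lambda>t. norm (complex_of_real t powr (of_real y - 1) / of_real (exp t))) integrable_on {0<..}"
      using absolutely_integrable_Gamma_integral'[of "of_real y"] that
      by (simp add: absolutely_integrable_on_def)
    thus ?thesis
      by (rule integrable_eq) (auto simp: norm_divide norm_powr_real_powr)
  qed
  have "(\<lambda>u::real. 2 * (u powr (1/2 - 1) / exp u) + u powr (2 - 1) / exp u) integrable_on {0<..}"
    by (intro integrable_add integrable_on_mult_right *) auto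
  thus ?thesis
    by (rule integrable_eq) (auto simp: add_divide_distrib)
qed

text \<open>This is the derivative of Gamma at 1, taken under the integral sign along z = i / (k +
  1). On the imaginary axis norm (u powr z - 1) \<le> |z| |ln u|, so the difference quotients have
  the k-independent majorant |ln u| / exp u.\<close>

lemma has_integral_ln_exp:
  "((\<lambda>u. complex_of_real (ln u / exp u)) has_integral - euler_mascheroni) {0<..}"
proof (rule has_integral_dominated_convergence[OF _ ln_exp_majorant_integrable])
  define z where "z = (\<lambda>k::nat. \<i> * complex_of_real (1 / real (Suc k)))"
  have z0: "z k \<noteq> 0" for k by (simp add: z_def del: of_nat_Suc)
  have nz: "norm (z k) = 1 / real (Suc k)" for k by (simp add: z_def norm_mult norm_divide del: of_nat_Suc)
  have Re_z: "Re (z k) = 0" for k by (simp add: z_def)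
  have z_lim: "filterlim z (at 0) sequentially"
    unfolding filterlim_at
  proof
    have "(\<lambda>k. \<i> * complex_of_real (1 / real (Suc k))) \<longlonglongrightarrow> \<i> * complex_of_real 0"
      by (intro tendsto_intros LIMSEQ_Suc lim_1_over_n)
    thus "z \<longlonglongrightarrow> 0" by (simp add: z_def)
  qed (use z0 in auto)
  show "((\<lambda>u. (of_real u powr (z k) - 1) / z k / of_real (exp u)) has_integral ((Gamma (1 + z k) - 1) / z k)) {0<..}" for k
  proof -
    have A: "((\<lambda>u. (of_real u powr (1 + z k - 1) / of_real (exp u) - of_real u powr (1 - 1) / of_real (exp u)) / z k) has_integral
        ((Gamma (1 + z k) - Gamma 1) / z k)) {0<..}"
      by (intro has_integral_divide has_integral_diff Gamma_integral_complex') (simp_all add: Re_z)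
    have B: "(of_real u powr (1 + z k - 1) / of_real (exp u) - of_real u powr (1 - 1) / of_real (exp u)) / z k
        = (of_real u powr (z k) - 1) / z k / of_real (exp u)" if "u \<in> {0<..}" for u
      using that z0[of k] by (auto simp: field_simps)
    show ?thesis using has_integral_eq[OF B A] by simp
  qed
  show "\<forall>u\<in>{0<..}. norm ((of_real u powr (z k) - 1) / z k / of_real (exp u)) \<le> (2 * u powr (-1/2) + u) / exp u" for k
  proof
    fix u :: real assume u: "u \<in> {0<..}"
    have "of_real u powr z k = exp (\<i> * of_real (ln u / real (Suc k)))"
      using u by (simp add: powr_def Ln_of_real z_def mult_ac)
    hence "norm (of_real u powr (z k) - 1) \<le> \<bar>ln u\<bar> / real (Suc k)"
      using norm_exp_imaginary_minus_1_le[of "ln u / real (Suc k)"] by simp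
    hence "norm ((of_real u powr (z k) - 1) / z k) \<le> \<bar>ln u\<bar>"
      unfolding norm_divide nz by (simp add: field_simps del: of_nat_Suc)
    also have "\<dots> \<le> 2 * u powr (-1/2) + u" using u by (intro abs_ln_le_powr) auto
    finally show "norm ((of_real u powr (z k) - 1) / z k / of_real (exp u)) \<le> (2 * u powr (-1/2) + u) / exp u"
      unfolding norm_divide[of _ "of_real (exp u)"] by (simp add: divide_right_mono)
  qed
  show "\<forall>u\<in>{0<..}. (\<lambda>k. (of_real u powr (z k) - 1) / z k / of_real (exp u)) \<longlonglongrightarrow> complex_of_real (ln u / exp u)"
  proof
    fix u :: real assume u: "u \<in> {0<..}"
    have "((\<lambda>z. complex_of_real u powr z) has_field_derivative of_real (ln u)) (at 0)"
      using u by (auto intro!: derivative_eq_intros simp: Ln_of_real)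
    hence "((\<lambda>z. (of_real u powr z - 1) / z) \<longlongrightarrow> complex_of_real (ln u)) (at 0)"
      using u by (simp add: has_field_derivative_iff)
    from filterlim_compose[OF this z_lim]
    show "(\<lambda>k. (of_real u powr (z k) - 1) / z k / of_real (exp u)) \<longlonglongrightarrow> complex_of_real (ln u / exp u)"
      unfolding of_real_divide by (intro tendsto_divide) auto
  qed
  have "(Gamma has_field_derivative - euler_mascheroni) (at (1::complex))"
    by (auto intro!: derivative_eq_intros simp: one_notin_nonpos_Ints)
  hence "((\<lambda>h. (Gamma (1 + h) - 1) / h) \<longlongrightarrow> - euler_mascheroni) (at (0::complex))"
    by (simp add: DERIV_def)
  from filterlim_compose[OF this z_lim]
  show "(\<lambda>k. (Gamma (1 + z k) - 1) / z k) \<longlonglongrightarrow> - euler_mascheroni" .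
qed

lemma ln_exp_absolutely_integrable:
  "(\<lambda>u. complex_of_real (ln u / exp u)) absolutely_integrable_on {0<..}"
proof (rule absolutely_integrable_integrable_bound[OF _ _ ln_exp_majorant_integrable])
  show "(\<lambda>u. complex_of_real (ln u / exp u)) integrable_on {0<..}"
    using has_integral_ln_exp by (auto simp: integrable_on_def)
qed (auto simp: norm_divide intro!: divide_right_mono abs_ln_le_powr[simplified])

lemma exp_minus_absolutely_integrable:
  "(\<lambda>u::real. complex_of_real (1 / exp u)) absolutely_integrable_on {0<..}"
  "((\<lambda>u::real. complex_of_real (1 / exp u)) has_integral 1) {0<..}"
proof -
  show "((\<lambda>u::real. complex_of_real (1 / exp u)) has_integral 1) {0<..}"
    by (rule has_integral_eq[OF _ Gamma_integral_complex'[of 1, simplified]]) auto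
  show "(\<lambda>u::real. complex_of_real (1 / exp u)) absolutely_integrable_on {0<..}"
    by (rule absolutely_integrable_spike[OF absolutely_integrable_Gamma_integral'[of 1], of "{}"]) auto
qed

text \<open>Taking norms inside the Gamma integral reduces the claim to Gamma 2 = 1. The line Re z =
  2 is two applications of the functional equation away from the imaginary axis.\<close>

lemma norm_Gamma_Re_2_le:
  assumes "Re z = 2" shows "norm (Gamma z) \<le> 1"
proof -
  have 1: "((\<lambda>t. of_real t powr (z - 1) / of_real (exp t)) has_integral Gamma z) {0<..}"
    by (rule Gamma_integral_complex') (simp add: assms)
  have 2: "((\<lambda>t. of_real t powr (2 - 1) / of_real (exp t)) has_integral (Gamma 2 :: complex)) {0<..}"
    by (rule Gamma_integral_complex') simp
  \<comment> \<open>The inner product with 1 is the real part; it allows the complex-valued Gamma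
    integral at 2 to serve as majorant.\<close>
  have "norm (integral {0<..} (\<lambda>t. of_real t powr (z - 1) / of_real (exp t))) \<le>
      integral {0<..} (\<lambda>t. of_real t powr (2 - 1) / of_real (exp t)) \<bullet> (1::complex)"
  proof (rule integral_norm_bound_integral_component)
    show "(\<lambda>t. of_real t powr (z - 1) / of_real (exp t)) integrable_on {0<..}"
      using 1 by (auto simp: integrable_on_def)
    show "(\<lambda>t. of_real t powr (2 - 1) / of_real (exp t) :: complex) integrable_on {0<..}"
      using 2 by (auto simp: integrable_on_def)
    fix t :: real assume "t \<in> {0<..}"
    thus "norm (of_real t powr (z - 1) / of_real (exp t)) \<le> (of_real t powr (2 - 1) / of_real (exp t) :: complex) \<bullet> 1"
      using assms by (simp add: norm_divide norm_powr_real_powr inner_complex_def powr_of_real)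
  qed
  also have "integral {0<..} (\<lambda>t. of_real t powr (2 - 1) / of_real (exp t)) = (Gamma 2 :: complex)"
    using 2 by (rule integral_unique)
  also have "\<dots> \<bullet> 1 = 1" using Gamma_fact[of 1, where ?'a = complex] by (simp add: inner_complex_def)
  finally show ?thesis using 1 by (simp add: integral_unique)
qed

text \<open>Gamma (z + 2) = (z + 1) z Gamma z has norm at most 1, and norm (z + 1) \<ge> norm z on
  the imaginary axis. The true decay is exponential, but quadratic decay already gives summability
  over the integers.\<close>

lemma norm_Gamma_imaginary_le:
  assumes "Re z = 0" "z \<noteq> 0"
  shows "norm (Gamma z) \<le> 1 / (norm z)\<^sup>2"
proof -
  have n1: "1 + z \<noteq> 0" using assms by (auto simp: complex_eq_iff)
  have ni: "z \<notin> \<int>\<^sub>\<le>\<^sub>0"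
    using assms by (auto elim!: nonpos_Ints_cases)
  have ni1: "z + 1 \<notin> \<int>\<^sub>\<le>\<^sub>0"
    using assms by (auto elim!: nonpos_Ints_cases simp: complex_eq_iff)
  have "Gamma (z + 1 + 1) = (z + 1) * (z * Gamma z)"
    using Gamma_plus1[OF ni] Gamma_plus1[OF ni1] by simp
  moreover have "norm (Gamma (z + 1 + 1)) \<le> 1"
    by (rule norm_Gamma_Re_2_le) (simp add: assms)
  ultimately have 1: "norm (z + 1) * norm z * norm (Gamma z) \<le> 1" by (simp add: norm_mult mult.assoc)
  have "norm z \<le> norm (z + 1)"
    using assms by (auto simp: cmod_def intro!: real_le_rsqrt)
  hence "norm z * norm z * norm (Gamma z) \<le> 1"
    using 1 by (smt (verit) mult_right_mono norm_ge_zero zero_le_mult_iff)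
  thus ?thesis using assms by (simp add: field_simps power2_eq_square)
qed

section \<open>The substitution u = x exp (w v) on growing windows\<close>

text \<open>The window is what the first K shifted periods on each side cover: [-1/2, K - 1/2] and
  [-K - 1/2, -1/2]. Since x w exp (w v) is the Jacobian, the window integral is that of \<phi> over
  [a K, b K], and dominated convergence with the norm of \<phi> as majorant gives the limit.\<close>

lemma integral_substitution_exp_tendsto:
  fixes \<phi> :: "real \<Rightarrow> complex" and x w :: real
  assumes x: "x > 0" and w: "w > 0"
    and cont: "continuous_on {0<..} \<phi>" and ai: "\<phi> absolutely_integrable_on {0<..}"
  shows "(\<lambda>K::nat. integral {- real K - 1/2..real K - 1/2} (\<lambda>v. of_real (x * w * exp (w * v)) * \<phi> (x * exp (w * v))))
           \<longlonglongrightarrow> integral {0<..} \<phi>"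
proof -
  define a where "a = (\<lambda>K::nat. x * exp (w * (- real K - 1/2)))"
  define b where "b = (\<lambda>K::nat. x * exp (w * (real K - 1/2)))"
  have apos: "a K > 0" for K using x by (simp add: a_def)
  have sub: "{a K..b K} \<subseteq> {0<..}" for K using apos[of K] by auto
  have le: "a K \<le> b K" for K using x w by (simp add: a_def b_def)
  have eq: "integral {- real K - 1/2..real K - 1/2} (\<lambda>v. of_real (x * w * exp (w * v)) * \<phi> (x * exp (w * v)))
      = integral {a K..b K} \<phi>" for K
  proof (rule integral_unique)
    have "((\<lambda>v. (x * w * exp (w * v)) *\<^sub>R \<phi> (x * exp (w * v))) has_integral
       integral {x * exp (w * (- real K - 1/2))..x * exp (w * (real K - 1/2))} \<phi>) {- real K - 1/2..real K - 1/2}"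
    proof (rule has_integral_substitution[where c = "a K" and d = "b K"])
      show "continuous_on {a K..b K} \<phi>"
        by (rule continuous_on_subset[OF cont sub])
      show "(\<lambda>v. x * exp (w * v)) ` {- real K - 1/2..real K - 1/2} \<subseteq> {a K..b K}"
        using x w by (auto simp: a_def b_def)
    qed (use x w le[of K] in \<open>auto intro!: derivative_eq_intros simp: a_def b_def\<close>)
    thus "((\<lambda>v. of_real (x * w * exp (w * v)) * \<phi> (x * exp (w * v))) has_integral integral {a K..b K} \<phi>)
            {- real K - 1/2..real K - 1/2}"
      by (simp add: a_def b_def scaleR_conv_of_real)
  qed
  have alim: "a \<longlonglongrightarrow> 0" unfolding a_def using w by real_asymp
  have blim: "filterlim b at_top sequentially" unfolding b_def using w x by real_asymp
  have int: "\<phi> integrable_on {a K..b K}" for K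
    by (rule integrable_continuous_interval[OF continuous_on_subset[OF cont sub]])
  have "(\<lambda>K. integral {0<..} (\<lambda>u. if u \<in> {a K..b K} then \<phi> u else 0)) \<longlonglongrightarrow> integral {0<..} \<phi>"
  proof (rule dominated_convergence(2)[where h = "\<lambda>u. norm (\<phi> u)"])
    show "(\<lambda>u. if u \<in> {a K..b K} then \<phi> u else 0) integrable_on {0<..}" for K
      using int[of K] integrable_restrict_Int[of "{a K..b K}" \<phi> "{0<..}"] sub[of K] by (simp add: Int_absorb2)
    show "(\<lambda>u. norm (\<phi> u)) integrable_on {0<..}"
      using ai by (simp add: absolutely_integrable_on_def)
    fix u :: real assume u: "u \<in> {0<..}"
    have "eventually (\<lambda>K. a K < u) sequentially"
      using order_tendstoD(2)[OF alim, of u] u by simp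
    moreover have "eventually (\<lambda>K. b K \<ge> u) sequentially"
      using blim by (simp add: filterlim_at_top)
    ultimately have "eventually (\<lambda>K. (if u \<in> {a K..b K} then \<phi> u else 0) = \<phi> u) sequentially"
      by eventually_elim auto
    thus "(\<lambda>K. if u \<in> {a K..b K} then \<phi> u else 0) \<longlonglongrightarrow> \<phi> u"
      by (rule tendsto_eventually)
  qed auto
  moreover have "integral {0<..} (\<lambda>u. if u \<in> {a K..b K} then \<phi> u else 0) = integral {a K..b K} \<phi>" for K
    using integral_restrict_Int[of "{0<..}" "{a K..b K}" \<phi>] sub[of K] by (simp add: Int_absorb2)
  ultimately show ?thesis unfolding eq by simp
qed

section \<open>Double series and unordered sums over the nonzero integers\<close>

text \<open>The product bound makes the family absolutely summable over all pairs, so both iterated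
  sums equal the one unordered sum \<open>S\<close>.\<close>

lemma sums_swap_dominated:
  fixes t :: "nat \<Rightarrow> nat \<Rightarrow> real"
  assumes le: "\<And>j k. \<bar>t j k\<bar> \<le> a j * b k"
    and a: "summable a" "\<And>j. a j \<ge> 0" and b: "summable b" "\<And>k. b k \<ge> 0"
    and rows: "\<And>j. (\<lambda>k. t j k) sums r j" and cols: "\<And>k. (\<lambda>j. t j k) sums c k"
  shows "summable r" "summable c" "suminf r = suminf c"
proof -
  have ba: "(b has_sum suminf b) UNIV"
    using b by (intro norm_summable_imp_has_sum) (auto simp: summable_sums)
  have "(\<lambda>(j, k). a j * b k) summable_on UNIV \<times> UNIV"
  proof (rule summable_on_SigmaI)
    show "((\<lambda>k. case (j, k) of (j, k) \<Rightarrow> a j * b k) has_sum (a j * suminf b)) UNIV" for j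
      using ba by (simp add: has_sum_cmult_right)
    show "(\<lambda>j. a j * suminf b) summable_on UNIV"
      using a by (intro summable_on_cmult_left norm_summable_imp_summable_on) auto
  qed (use a b in auto)
  hence "(\<lambda>p. norm (case_prod t p)) summable_on UNIV \<times> UNIV"
    by (rule Infinite_Sum.abs_summable_on_comparison_test') (use le in auto)
  hence "case_prod t summable_on UNIV \<times> UNIV" by (rule abs_summable_summable)
  then obtain S where S: "(case_prod t has_sum S) (UNIV \<times> UNIV)" by (auto simp: summable_on_def)
  have "(r has_sum S) UNIV"
  proof (rule has_sum_SigmaD[OF S])
    fix j
    have "summable (\<lambda>k. norm (t j k))"
      by (rule summable_comparison_test'[of "\<lambda>k. a j * b k"]) (use le b in \<open>auto intro: summable_mult\<close>)
    thus "((\<lambda>k. case_prod t (j, k)) has_sum r j) UNIV"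
      using norm_summable_imp_has_sum[OF _ rows] by simp
  qed
  moreover have "(c has_sum S) UNIV"
  proof (rule has_sum_SigmaD[OF iffD1[OF has_sum_swap S]])
    fix k
    have "summable (\<lambda>j. norm (t j k))"
      by (rule summable_comparison_test'[of "\<lambda>j. a j * b k"]) (use le a in \<open>auto intro: summable_mult2\<close>)
    thus "((\<lambda>j. case (k, j) of (k, j) \<Rightarrow> case_prod t (j, k)) has_sum c k) UNIV"
      using norm_summable_imp_has_sum[OF _ cols] by simp
  qed
  ultimately have "r sums S" "c sums S" by (auto intro: has_sum_imp_sums)
  thus "summable r" "summable c" "suminf r = suminf c"
    by (auto simp: sums_iff)
qed

lemma inverse_square_summable_on_nonzero_int:
  "(\<lambda>n::int. 1 / (of_int n)\<^sup>2 :: real) summable_on UNIV - {0}"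
proof -
  have s: "summable (\<lambda>n::nat. 1 / (real (Suc n))\<^sup>2)"
    using inverse_power_summable[of 2, where ?'a = real]
    by (subst summable_Suc_iff) (simp add: field_simps)
  have 0: "(\<lambda>n::nat. 1 / (real (Suc n))\<^sup>2) summable_on UNIV"
    using s by (intro norm_summable_imp_summable_on) simp
  have 1: "(\<lambda>n::int. 1 / (of_int n)\<^sup>2 :: real) summable_on range (\<lambda>n. int (Suc n))"
    by (subst summable_on_reindex) (use 0 in \<open>auto simp: o_def inj_def\<close>)
  have 2: "(\<lambda>n::int. 1 / (of_int n)\<^sup>2 :: real) summable_on range (\<lambda>n. - int (Suc n))"
  proof (subst summable_on_reindex)
    have "(\<lambda>n::int. 1 / (of_int n)\<^sup>2) \<circ> (\<lambda>n. - int (Suc n)) = (\<lambda>n::nat. 1 / (real (Suc n))\<^sup>2)"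
      by (simp add: fun_eq_iff power2_eq_square algebra_simps)
    thus "(\<lambda>n::int. 1 / (of_int n)\<^sup>2 :: real) \<circ> (\<lambda>n. - int (Suc n)) summable_on UNIV"
      using 0 by simp
  qed (auto simp: inj_def)
  have "n \<in> range (\<lambda>n. int (Suc n)) \<union> range (\<lambda>n. - int (Suc n))" if "n \<noteq> 0" for n :: int
  proof (cases "n > 0")
    case True
    hence "n = int (Suc (nat (n - 1)))" by simp
    thus ?thesis by blast
  next
    case False
    hence "n = - int (Suc (nat (- n - 1)))" using that by simp
    thus ?thesis by blast
  qed
  hence "UNIV - {0::int} = range (\<lambda>n. int (Suc n)) \<union> range (\<lambda>n. - int (Suc n))" by auto
  thus ?thesis using 1 2 by (auto intro!: summable_on_Un_disjoint)
qed

text \<open>Every finite set of nonzero integers lies in a symmetric interval, so these intervals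
  are cofinal. This identifies the limit of symmetric Fourier sums with the unordered sum in the
  theorem.\<close>

lemma has_sum_nonzero_int_symmetric_partial_sums:
  assumes "(T has_sum S) (UNIV - {0::int})"
  shows "(\<lambda>N. \<Sum>n\<in>{- int N..int N} - {0}. T n) \<longlonglongrightarrow> S"
proof -
  have "filterlim (\<lambda>N. {- int N..int N} - {0}) (finite_subsets_at_top (UNIV - {0})) sequentially"
    unfolding filterlim_finite_subsets_at_top
  proof safe
    fix X :: "int set" assume X: "finite X" "X \<subseteq> UNIV - {0}"
    \<comment> \<open>Inserting 0 makes \<open>Max\<close> meaningful also for empty
      \<open>X\<close>.\<close>
    define B where "B = Max (insert 0 (abs ` X))"
    have B: "\<bar>n\<bar> \<le> B" if "n \<in> X" for n
      unfolding B_def using X that by (intro Max_ge) auto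
    show "eventually (\<lambda>N. finite ({- int N..int N} - {0}) \<and> X \<subseteq> {- int N..int N} - {0} \<and>
        {- int N..int N} - {0} \<subseteq> UNIV - {0}) sequentially"
      using eventually_ge_at_top[of "nat B"]
    proof eventually_elim
      case (elim N)
      hence "\<bar>n\<bar> \<le> int N" if "n \<in> X" for n using B[OF that] by linarith
      thus ?case using X by (auto simp: abs_le_iff) (metis minus_le_iff)+
    qed
  qed
  from filterlim_compose[OF assms[unfolded has_sum_def] this] show ?thesis .
qed

section \<open>The double exponential, its derivative, and the series \<open>G\<close>\<close>

locale double_exponential =
  fixes x w :: real
  assumes x: "x > 0" and w: "w > 0"
begin

definition F :: "real \<Rightarrow> real" where "F v = exp (- x * exp (w * v))"
text \<open>Minus the derivative of \<open>F\<close>. Under u = x exp (w v), f v dv becomes exp (-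
  u) du.\<close>

definition f :: "real \<Rightarrow> real" where "f v = x * w * exp (w * v) * F v"

lemma F_deriv: "(F has_field_derivative - f v) (at v within A)"
  unfolding F_def f_def by (auto intro!: derivative_eq_intros)

lemma F_vector_deriv: "((\<lambda>v. complex_of_real (F v - c)) has_vector_derivative - of_real (f v)) (at v within A)"
proof -
  have "((\<lambda>v. F v - c) has_field_derivative - f v) (at v within A)"
    by (auto intro!: derivative_eq_intros F_deriv)
  from has_vector_derivative_of_real[OF this] show ?thesis by simp
qed

lemma continuous_F [continuous_intros]: "continuous_on A F"
  unfolding F_def by (intro continuous_intros)

lemma continuous_f [continuous_intros]: "continuous_on A f"
  unfolding f_def by (intro continuous_intros)

lemma F_pos: "F v > 0" and F_le_1: "F v \<le> 1"
  using x by (auto simp: F_def)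

lemma F_le: "F v \<le> exp (- (w * v)) / x"
proof -
  define y where "y = x * exp (w * v)"
  have y: "y > 0" using x by (simp add: y_def)
  have "y \<le> exp y" using exp_ge_add_one_self[of y] by linarith
  hence "exp (- y) \<le> 1 / y" using y by (simp add: exp_minus field_simps)
  thus ?thesis by (simp add: F_def y_def exp_minus field_simps)
qed

lemma one_minus_F_le: "1 - F v \<le> x * exp (w * v)"
  using exp_ge_add_one_self[of "- x * exp (w * v)"] by (simp add: F_def)

lemma f_nonneg: "f v \<ge> 0"
  using x w F_pos[of v] by (simp add: f_def)

lemma f_le_left: "f v \<le> x * w * exp (w * v)"
  using x w F_le_1[of v] mult_left_mono[of "F v" 1 "x * w * exp (w * v)"] by (simp add: f_def)

lemma f_le_right: "f v \<le> 4 * w / x * exp (- (w * v))"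
proof -
  define y where "y = x * exp (w * v)"
  have y: "y > 0" using x by (simp add: y_def)
  \<comment> \<open>The factor y in \<open>f\<close> uses up one power of decay, so exp (- y) \<le>
    4 / y^2 is needed; squaring this inequality provides it and is the origin of the 4.\<close>
  have "y / 2 \<le> exp (y / 2)" using exp_ge_add_one_self[of "y/2"] by linarith
  hence "(y / 2)^2 \<le> exp (y / 2)^2" using y by (intro power_mono) auto
  also have "exp (y / 2)^2 = exp y" by (simp flip: exp_double)
  finally have "y * exp (- y) \<le> 4 / y" using y by (simp add: exp_minus field_simps power2_eq_square)
  hence "w * (y * exp (- y)) \<le> w * (4 / y)" using w by (intro mult_left_mono) auto
  also have "w * (y * exp (- y)) = f v" by (simp add: f_def F_def y_def)
  also have "w * (4 / y) = 4 * w / x * exp (- (w * v))" by (simp add: y_def exp_minus field_simps)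
  finally show ?thesis .
qed

text \<open>The k-th right term is paired with the k-th left term, so that each \<open>q k\<close>
  extends the unfolded range by one period at both ends. The extra - 1 in the argument starts the
  left translates at index 1.\<close>

definition q :: "nat \<Rightarrow> real \<Rightarrow> real" where
  "q k v = F (v + real k) + (F (v - real k - 1) - 1)"

definition G :: "real \<Rightarrow> real" where "G v = (\<Sum>k. q k v)"

lemma q_deriv: "(q k has_field_derivative - f (v + real k) - f (v - real k - 1)) (at v within A)"
  unfolding q_def
  by (rule derivative_eq_intros DERIV_chain2[OF F_deriv] refl | simp)+

lemma continuous_q [continuous_intros]: "continuous_on A (q k)"
  by (rule DERIV_continuous_on[OF q_deriv])

lemma exp_w_shift_le:
  assumes "\<bar>v\<bar> \<le> 1"
  shows "exp (- (w * (v + real k))) \<le> exp w * exp (- w) ^ k"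
    "exp (w * (v - real k - 1)) \<le> exp (- w) ^ k"
proof -
  have 1: "w * v \<le> w" and 2: "- (w * v) \<le> w"
    using assms w mult_left_mono[of v 1 w] mult_left_mono[of "-v" 1 w] by (auto simp: abs_le_iff)
  have e: "exp (- w) ^ k = exp (- (w * real k))"
    by (simp add: exp_of_nat_mult[symmetric] mult.commute)
  show "exp (- (w * (v + real k))) \<le> exp w * exp (- w) ^ k"
    unfolding e using 2 by (simp add: exp_add[symmetric] algebra_simps)
  show "exp (w * (v - real k - 1)) \<le> exp (- w) ^ k"
    unfolding e using 1 by (simp add: algebra_simps)
qed

lemma abs_q_le:
  assumes "\<bar>v\<bar> \<le> 1"
  shows "\<bar>q k v\<bar> \<le> (exp w / x + x) * exp (- w) ^ k"
proof -
  have "\<bar>q k v\<bar> \<le> F (v + real k) + (1 - F (v - real k - 1))"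
    using F_pos[of "v + real k"] F_le_1[of "v - real k - 1"] by (simp add: q_def)
  also have "\<dots> \<le> exp (- (w * (v + real k))) / x + x * exp (w * (v - real k - 1))"
    by (intro add_mono F_le one_minus_F_le)
  also have "\<dots> \<le> exp w * exp (- w) ^ k / x + x * exp (- w) ^ k"
    using x by (intro add_mono divide_right_mono mult_left_mono exp_w_shift_le assms) auto
  finally show ?thesis by (simp add: algebra_simps)
qed

lemma abs_q_deriv_le:
  assumes "\<bar>v\<bar> \<le> 1"
  shows "\<bar>- f (v + real k) - f (v - real k - 1)\<bar> \<le> (4 * w / x * exp w + x * w) * exp (- w) ^ k"
proof -
  have "\<bar>- f (v + real k) - f (v - real k - 1)\<bar> = f (v + real k) + f (v - real k - 1)"
    using f_nonneg[of "v + real k"] f_nonneg[of "v - real k - 1"] by simp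
  also have "\<dots> \<le> 4 * w / x * exp (- (w * (v + real k))) + x * w * exp (w * (v - real k - 1))"
    by (intro add_mono f_le_left f_le_right)
  also have "\<dots> \<le> 4 * w / x * (exp w * exp (- w) ^ k) + x * w * exp (- w) ^ k"
    using x w by (intro add_mono mult_left_mono exp_w_shift_le assms) auto
  finally show ?thesis by (simp add: algebra_simps)
qed

lemma summable_geometric_w: "summable (\<lambda>k. C * exp (- w) ^ k)"
  using w by (intro summable_mult summable_geometric) auto

lemma summable_q:
  assumes "\<bar>v\<bar> \<le> 1" shows "summable (\<lambda>k. q k v)"
  by (rule summable_comparison_test'[OF summable_geometric_w[of "exp w / x + x"], where N = 0])
     (use abs_q_le[OF assms] in auto)

text \<open>Termwise differentiation with a geometric majorant. Working on [-1, 1] puts the whole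
  closed period [-1/2, 1/2] in the interior, so this yields continuity there as well as the
  derivative at 0.\<close>

lemma G_deriv:
  assumes "\<bar>v\<bar> < 1"
  shows "(G has_field_derivative (\<Sum>k. - f (v + real k) - f (v - real k - 1))) (at v)"
  unfolding G_def[abs_def]
proof (rule has_field_derivative_series'(2)[where S = "{-1..1}" and ?x0.0 = 0])
  show "uniformly_convergent_on {-1..1} (\<lambda>n v. \<Sum>k<n. - f (v + real k) - f (v - real k - 1))"
    by (rule Weierstrass_m_test'[OF _ summable_geometric_w]) (use abs_q_deriv_le in \<open>auto simp: abs_le_iff\<close>)
  show "summable (\<lambda>k. q k 0)" by (rule summable_q) simp
qed (use assms in \<open>auto intro: q_deriv\<close>)

lemma continuous_G: "continuous_on {-1/2..1/2} G"
  by (rule DERIV_continuous_on[OF DERIV_subset[OF G_deriv]]) auto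

section \<open>Unfolding the integrals over one period\<close>

text \<open>The constant c is free because it disappears on differentiation: it will be 0 on the
  right translates and 1 on the left ones, so that F - c decays on either side.\<close>

lemma integral_by_parts_F:
  fixes \<Phi> E :: "real \<Rightarrow> complex"
  assumes "a \<le> b" and \<Phi>: "\<And>v. (\<Phi> has_vector_derivative E v) (at v)"
  shows "integral {a..b} (\<lambda>v. of_real (F v - c) * E v) =
     of_real (F b - c) * \<Phi> b - of_real (F a - c) * \<Phi> a + integral {a..b} (\<lambda>v. of_real (f v) * \<Phi> v)"
proof (rule integral_unique, rule integration_by_parts[OF bounded_bilinear.flip[OF bounded_bilinear_mult] assms(1),
      where f = \<Phi> and g = "\<lambda>v. of_real (F v - c)" and g' = "\<lambda>v. - of_real (f v)"])
  have c\<Phi>: "continuous_on A \<Phi>" for A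
    by (intro continuous_at_imp_continuous_on ballI has_vector_derivative_continuous[OF \<Phi>])
  show "continuous_on {a..b} \<Phi>" by (rule c\<Phi>)
  show "continuous_on {a..b} (\<lambda>v. complex_of_real (F v - c))" by (intro continuous_intros)
  have "((\<lambda>v. of_real (f v) * \<Phi> v) has_integral integral {a..b} (\<lambda>v. of_real (f v) * \<Phi> v)) {a..b}"
    by (intro integrable_integral integrable_continuous_interval continuous_intros c\<Phi>)
  from has_integral_neg[OF this]
  show "((\<lambda>v. - complex_of_real (f v) * \<Phi> v) has_integral
     of_real (F b - c) * \<Phi> b - of_real (F a - c) * \<Phi> a -
     (of_real (F b - c) * \<Phi> b - of_real (F a - c) * \<Phi> a + integral {a..b} (\<lambda>v. of_real (f v) * \<Phi> v))) {a..b}"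
    by simp
qed (rule \<Phi> F_vector_deriv)+

text \<open>Two instances are intended: E = 1 with \<Phi> v = v, and E v = cis (s v) with its
  bounded primitive. The linear growth bound on \<Phi> covers both.\<close>

context
  fixes E \<Phi> :: "real \<Rightarrow> complex" and L :: complex and C :: real
  assumes E_cont: "\<And>A. continuous_on A E" and E_period: "\<And>v k. E (v + real k) = E v"
    and \<Phi>: "\<And>v. (\<Phi> has_vector_derivative E v) (at v)"
    and \<Phi>_le: "\<And>v. norm (\<Phi> v) \<le> C + \<bar>v\<bar>"
    and L: "(\<lambda>K::nat. integral {- real K - 1/2..real K - 1/2} (\<lambda>v. of_real (f v) * \<Phi> v)) \<longlonglongrightarrow> L"
begin

text \<open>Boundary values at inner half-integers telescope. At -1/2 the right part leaves - F
  \<Phi> and the left part (F - 1) \<Phi>, whose sum is the surviving - \<Phi> (-1/2).\<close>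

lemma sum_integral_q:
  "(\<Sum>k<K. integral {-1/2..1/2} (\<lambda>v. of_real (q k v) * E v)) =
     of_real (F (real K - 1/2)) * \<Phi> (real K - 1/2) - \<Phi> (-1/2)
      - of_real (F (- real K - 1/2) - 1) * \<Phi> (- real K - 1/2)
      + integral {- real K - 1/2..real K - 1/2} (\<lambda>v. of_real (f v) * \<Phi> v)"
proof (induction K)
  case 0
  show ?case by (simp add: algebra_simps)
next
  case (Suc K)
  have c\<Phi>: "continuous_on A \<Phi>" for A
    by (intro continuous_at_imp_continuous_on ballI has_vector_derivative_continuous[OF \<Phi>])
  let ?f = "\<lambda>v. of_real (f v) * \<Phi> v"
  have int: "?f integrable_on {a..b}" for a b
    by (intro integrable_continuous_interval continuous_intros c\<Phi>)
  \<comment> \<open>Periodicity is assumed for natural shifts only; applied at the shifted point it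
    gives the negative shift.\<close>
  have E_shift: "E (v + (- real K - 1)) = E v" for v
    using E_period[of "v + (- real K - 1)" "Suc K"] by simp
  have "integral {-1/2..1/2} (\<lambda>v. of_real (q K v) * E v) =
     integral {-1/2..1/2} (\<lambda>v. of_real (F (v + real K) - 0) * E (v + real K)
       + of_real (F (v + (- real K - 1)) - 1) * E (v + (- real K - 1)))"
    unfolding E_period E_shift by (rule integral_cong) (simp add: q_def algebra_simps)
  also have "\<dots> = integral {-1/2..1/2} (\<lambda>v. of_real (F (v + real K) - 0) * E (v + real K))
       + integral {-1/2..1/2} (\<lambda>v. of_real (F (v + (- real K - 1)) - 1) * E (v + (- real K - 1)))"
    by (intro integral_add integrable_continuous_interval continuous_intros
          continuous_on_compose2[OF continuous_F[of UNIV]] continuous_on_compose2[OF E_cont[of UNIV]]) auto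
  also have "integral {-1/2..1/2} (\<lambda>v. of_real (F (v + real K) - 0) * E (v + real K)) =
      integral {-1/2 + real K..1/2 + real K} (\<lambda>v. of_real (F v - 0) * E v)"
    by (subst integral_shift[symmetric]) (auto intro!: continuous_intros E_cont simp: o_def)
  also have "\<dots> = of_real (F (1/2 + real K) - 0) * \<Phi> (1/2 + real K) - of_real (F (-1/2 + real K) - 0) * \<Phi> (-1/2 + real K)
      + integral {-1/2 + real K..1/2 + real K} ?f"
    by (rule integral_by_parts_F[OF _ \<Phi>]) simp
  also have "integral {-1/2..1/2} (\<lambda>v. of_real (F (v + (- real K - 1)) - 1) * E (v + (- real K - 1))) =
      integral {-1/2 + (- real K - 1)..1/2 + (- real K - 1)} (\<lambda>v. of_real (F v - 1) * E v)"
    by (subst integral_shift[symmetric]) (auto intro!: continuous_intros E_cont simp: o_def)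
  also have "\<dots> = of_real (F (1/2 + (- real K - 1)) - 1) * \<Phi> (1/2 + (- real K - 1))
      - of_real (F (-1/2 + (- real K - 1)) - 1) * \<Phi> (-1/2 + (- real K - 1))
      + integral {-1/2 + (- real K - 1)..1/2 + (- real K - 1)} ?f"
    by (rule integral_by_parts_F[OF _ \<Phi>]) simp
  finally have step: "integral {-1/2..1/2} (\<lambda>v. of_real (q K v) * E v) =
      of_real (F (real (Suc K) - 1/2)) * \<Phi> (real (Suc K) - 1/2) - of_real (F (real K - 1/2)) * \<Phi> (real K - 1/2)
      + integral {real K - 1/2..real (Suc K) - 1/2} ?f
      + (of_real (F (- real K - 1/2) - 1) * \<Phi> (- real K - 1/2)
      - of_real (F (- real (Suc K) - 1/2) - 1) * \<Phi> (- real (Suc K) - 1/2)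
      + integral {- real (Suc K) - 1/2..- real K - 1/2} ?f)"
    by (simp add: add_ac algebra_simps)
  have "integral {- real (Suc K) - 1/2..real (Suc K) - 1/2} ?f =
     integral {- real (Suc K) - 1/2..- real K - 1/2} ?f + integral {- real K - 1/2..real K - 1/2} ?f
      + integral {real K - 1/2..real (Suc K) - 1/2} ?f"
    by (subst Henstock_Kurzweil_Integration.integral_combine; (rule int)?; simp?)+
  thus ?case unfolding sum.lessThan_Suc Suc.IH step by (simp only: algebra_simps)
qed

text \<open>Uniform convergence exchanges sum and integral. The outer boundary terms vanish because
  F and F - 1 decay exponentially on their sides, against linear growth of \<Phi>.\<close>

lemma integral_G:
  "integral {-1/2..1/2} (\<lambda>v. of_real (G v) * E v) = L - \<Phi> (-1/2)"
proof -
  have "uniform_limit {-1/2..1/2} (\<lambda>n v. \<Sum>k<n. of_real (q k v) * E v) (\<lambda>v. \<Sum>k. of_real (q k v) * E v) sequentially"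
  proof -
    have "bounded (E ` {-1/2..1/2})"
      by (intro compact_imp_bounded compact_continuous_image E_cont) auto
    then obtain B where B: "\<And>v. v \<in> {-1/2..1/2} \<Longrightarrow> norm (E v) \<le> B" "B > 0"
      unfolding bounded_pos by (metis imageI)
    have "norm (of_real (q k v) * E v) \<le> ((exp w / x + x) * B) * exp (- w) ^ k" if "v \<in> {-1/2..1/2}" for v k
    proof -
      have "norm (of_real (q k v) * E v) \<le> ((exp w / x + x) * exp (- w) ^ k) * B"
        unfolding norm_mult norm_of_real
        using that x by (intro mult_mono abs_q_le B) auto
      thus ?thesis by (simp add: mult_ac)
    qed
    thus ?thesis using summable_geometric_w by (rule Weierstrass_m_test)
  qed
  then obtain I J where IJ: "\<And>n. ((\<lambda>v. \<Sum>k<n. of_real (q k v) * E v) has_integral I n) {-1/2..1/2}"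
      "((\<lambda>v. \<Sum>k. of_real (q k v) * E v) has_integral J) {-1/2..1/2}" "I \<longlonglongrightarrow> J"
    by (rule uniform_limit_integral) (auto intro!: continuous_intros E_cont)
  have I: "I n = (\<Sum>k<n. integral {-1/2..1/2} (\<lambda>v. of_real (q k v) * E v))" for n
  proof -
    have "I n = integral {-1/2..1/2} (\<lambda>v. \<Sum>k<n. of_real (q k v) * E v)"
      using IJ(1)[of n] by (simp add: integral_unique)
    also have "\<dots> = (\<Sum>k<n. integral {-1/2..1/2} (\<lambda>v. of_real (q k v) * E v))"
      by (intro integral_sum integrable_continuous_interval continuous_intros E_cont) auto
    finally show ?thesis .
  qed
  have G: "(\<Sum>k. of_real (q k v) * E v) = of_real (G v) * E v" if "v \<in> {-1/2..1/2}" for v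
  proof -
    have "summable (\<lambda>k. q k v)"
      using that by (intro summable_q) auto
    hence "(\<lambda>k. complex_of_real (q k v)) sums of_real (G v)"
      unfolding G_def by (intro sums_of_real summable_sums)
    thus ?thesis by (intro sums_unique[symmetric] sums_mult2)
  qed
  have J: "J = integral {-1/2..1/2} (\<lambda>v. of_real (G v) * E v)"
    unfolding integral_unique[OF IJ(2), symmetric] by (intro integral_cong G)
  have "(\<lambda>K. of_real (F (real K - 1/2)) * \<Phi> (real K - 1/2)) \<longlonglongrightarrow> 0"
  proof (rule tendsto_0_le[where K = 1])
    show "(\<lambda>K. exp (- (w * (real K - 1/2))) / x * (C + (real K + 1))) \<longlonglongrightarrow> 0"
      using w x by real_asymp
    have le: "norm (of_real (F (real K - 1/2)) * \<Phi> (real K - 1/2)) \<le> exp (- (w * (real K - 1/2))) / x * (C + (real K + 1))" for K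
      unfolding norm_mult norm_of_real
      using x F_pos[of "real K - 1/2"] F_le[of "real K - 1/2"] \<Phi>_le[of "real K - 1/2"] by (intro mult_mono) auto
    show "eventually (\<lambda>K. norm (of_real (F (real K - 1/2)) * \<Phi> (real K - 1/2)) \<le>
       norm (exp (- (w * (real K - 1/2))) / x * (C + (real K + 1))) * 1) sequentially"
      unfolding real_norm_def mult_1_right
      by (intro always_eventually allI order_trans[OF le abs_ge_self])
  qed
  moreover have "(\<lambda>K. of_real (F (- real K - 1/2) - 1) * \<Phi> (- real K - 1/2)) \<longlonglongrightarrow> 0"
  proof (rule tendsto_0_le[where K = 1])
    show "(\<lambda>K. x * exp (w * (- real K - 1/2)) * (C + (real K + 1))) \<longlonglongrightarrow> 0"
      using w x by real_asymp
    have le: "norm (of_real (F (- real K - 1/2) - 1) * \<Phi> (- real K - 1/2)) \<le> x * exp (w * (- real K - 1/2)) * (C + (real K + 1))" for K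
      unfolding norm_mult norm_of_real
      using x F_le_1[of "- real K - 1/2"] one_minus_F_le[of "- real K - 1/2"] \<Phi>_le[of "- real K - 1/2"] by (intro mult_mono) auto
    show "eventually (\<lambda>K. norm (of_real (F (- real K - 1/2) - 1) * \<Phi> (- real K - 1/2)) \<le>
       norm (x * exp (w * (- real K - 1/2)) * (C + (real K + 1))) * 1) sequentially"
      unfolding real_norm_def mult_1_right
      by (intro always_eventually allI order_trans[OF le abs_ge_self])
  qed
  ultimately have "I \<longlonglongrightarrow> 0 - \<Phi> (-1/2) - 0 + L"
    unfolding I sum_integral_q by (intro tendsto_intros L)
  with IJ(3) have "J = 0 - \<Phi> (-1/2) - 0 + L" by (rule LIMSEQ_unique)
  thus ?thesis unfolding J by simp
qed

end

section \<open>Fourier coefficients of \<open>P\<close> and its value at 0\<close>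

text \<open>The added linear term is ln u / w for u = x exp (w v); its constant part makes the mean
  of \<open>P\<close> independent of x.\<close>

definition P :: "real \<Rightarrow> complex" where "P v = of_real (v + ln x / w + G v)"

lemma integral_P: "integral {-1/2..1/2} P = of_real (1/2 - euler_mascheroni / w)"
proof -
  \<comment> \<open>This is v exp (- u) with v = (ln u - ln x) / w, that is, v f v dv in the
    variable u.\<close>
  define \<phi> where "\<phi> = (\<lambda>u. complex_of_real (ln u / exp u) * of_real (1 / w) - of_real (1 / exp u) * of_real (ln x / w))"
  have ai: "\<phi> absolutely_integrable_on {0<..}"
    unfolding \<phi>_def
    by (intro set_integral_diff(1) set_integrable_mult_left ln_exp_absolutely_integrable exp_minus_absolutely_integrable)
  have "(\<phi> has_integral (- euler_mascheroni * of_real (1 / w) - 1 * of_real (ln x / w))) {0<..}"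
    unfolding \<phi>_def
    by (intro has_integral_diff has_integral_mult_left has_integral_ln_exp exp_minus_absolutely_integrable)
  hence I: "integral {0<..} \<phi> = of_real ((- euler_mascheroni - ln x) / w)"
    by (simp add: integral_unique diff_divide_distrib)
  have cont: "continuous_on {0<..} \<phi>"
    unfolding \<phi>_def using w by (auto intro!: continuous_intros)
  have lim: "(\<lambda>K. integral {- real K - 1/2..real K - 1/2} (\<lambda>v. of_real (f v) * complex_of_real v))
        \<longlonglongrightarrow> of_real ((- euler_mascheroni - ln x) / w)"
  proof -
    have "of_real (x * w * exp (w * v)) * \<phi> (x * exp (w * v)) = of_real (f v) * complex_of_real v" for v
    proof -
      have "\<phi> (x * exp (w * v)) = of_real (v * F v)"
        using x w by (simp add: \<phi>_def F_def ln_mult exp_minus field_simps)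
      thus ?thesis by (simp add: f_def mult_ac)
    qed
    with integral_substitution_exp_tendsto[OF x w cont ai, unfolded I]
    show ?thesis by (simp only:)
  qed
  have G: "integral {-1/2..1/2} (\<lambda>v. of_real (G v) * 1) =
      of_real ((- euler_mascheroni - ln x) / w) - complex_of_real (-1/2)"
    by (rule integral_G[where C = 0, OF _ _ _ _ lim])
       (auto intro!: derivative_eq_intros has_vector_derivative_of_real)
  have "((\<lambda>v. complex_of_real (v + ln x / w)) has_integral
      of_real ((1/2)\<^sup>2 / 2 + (1/2) * (ln x / w)) - of_real ((-1/2)\<^sup>2 / 2 + (-1/2) * (ln x / w))) {-1/2..1/2}"
    by (rule fundamental_theorem_of_calculus, simp, rule has_vector_derivative_of_real)
       (use w in \<open>auto intro!: derivative_eq_intros\<close>)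
  hence A: "integral {-1/2..1/2} (\<lambda>v. complex_of_real (v + ln x / w)) = of_real (ln x / w)"
    by (simp add: integral_unique power2_eq_square)
  have P_eq: "P = (\<lambda>v. of_real (v + ln x / w) + of_real (G v) * 1)"
    by (simp add: fun_eq_iff P_def)
  have "integral {-1/2..1/2} P = integral {-1/2..1/2} (\<lambda>v. complex_of_real (v + ln x / w))
      + integral {-1/2..1/2} (\<lambda>v. of_real (G v) * 1)"
    unfolding P_eq using w
    by (intro integral_add integrable_continuous_interval continuous_intros continuous_G; simp)
  also have "\<dots> = of_real (1/2 - euler_mascheroni / w)"
    unfolding A G by (simp add: diff_divide_distrib)
  finally show ?thesis .
qed

text \<open>The exponent for which u powr \<rho> n, at u = x exp (w v), is cis (2 \<pi> n v) up to
  the factor x powr \<rho> n.\<close>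

definition \<rho> :: "int \<Rightarrow> complex" where "\<rho> n = 2 * of_real pi * \<i> * of_int n / of_real w"

text \<open>The boundary value - \<Phi> (-1/2) from \<open>integral_G\<close> cancels the
  coefficient of the linear term. What remains is Gamma (1 + z) / (i s) times the power of x, and z
  / (i s) = 1 / w.\<close>

lemma integral_P_cis:
  assumes n: "n \<noteq> 0"
  shows "integral {-1/2..1/2} (\<lambda>v. P v * cis (2 * pi * of_int n * v)) =
    Gamma (\<rho> n) * exp (- \<rho> n * of_real (ln x)) / of_real w"
proof -
  define s where "s = 2 * pi * of_int n"
  define z where "z = \<rho> n"
  have s: "s \<noteq> 0" using n by (simp add: s_def)
  have z: "z = \<i> * of_real s / of_real w" by (simp add: z_def \<rho>_def s_def)
  have z0: "z \<noteq> 0" using s w by (simp add: z)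
  have Re_z: "Re z = 0" by (simp add: z)
  have ni: "z \<notin> \<int>\<^sub>\<le>\<^sub>0" using Re_z z0 by (auto elim!: nonpos_Ints_cases)
  define \<Phi> where "\<Phi> = (\<lambda>v. cis (s * v) / (\<i> * of_real s))"
  have cis_half: "cis (s * (1/2)) = cis (s * (-1/2))"
    unfolding s_def by (rule cis_half_period)
  have \<Phi>: "(\<Phi> has_vector_derivative cis (s * v)) (at v within A)" for v A
    unfolding \<Phi>_def by (rule has_vector_derivative_cis_primitive[OF s])
  have period: "cis (s * (v + real k)) = cis (s * v)" for v k
  proof -
    have "cis (s * (v + real k)) = cis (s * v) * cis (2 * pi * of_int (n * int k))"
      unfolding cis_mult by (simp add: s_def algebra_simps)
    thus ?thesis by (simp only: cis_multiple_2pi Ints_of_int mult_1_right)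
  qed
  define c where "c = exp (- z * of_real (ln x)) / (\<i> * of_real s)"
  define \<phi> where "\<phi> = (\<lambda>u. complex_of_real u powr ((1 + z) - 1) / of_real (exp u) * c)"
  have ai: "\<phi> absolutely_integrable_on {0<..}"
    unfolding \<phi>_def
    by (intro set_integrable_mult_left absolutely_integrable_Gamma_integral') (simp add: Re_z)
  have "(\<phi> has_integral (Gamma (1 + z) * c)) {0<..}"
    unfolding \<phi>_def by (intro has_integral_mult_left Gamma_integral_complex') (simp add: Re_z)
  hence I: "integral {0<..} \<phi> = Gamma (1 + z) * c" by (rule integral_unique)
  have cont: "continuous_on {0<..} \<phi>"
    unfolding \<phi>_def by (auto intro!: continuous_intros)
  have "of_real (x * w * exp (w * v)) * \<phi> (x * exp (w * v)) = of_real (f v) * \<Phi> v" for v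
  proof -
    have "complex_of_real (x * exp (w * v)) powr z = exp (z * of_real (ln x + w * v))"
      using x by (simp add: powr_def Ln_of_real ln_mult del: of_real_mult of_real_add)
    also have "\<dots> * exp (- z * of_real (ln x)) = cis (s * v)"
    proof -
      have "z * of_real (ln x + w * v) + - z * of_real (ln x) = \<i> * of_real (s * v)"
        using w by (simp add: z algebra_simps)
      thus ?thesis by (simp only: cis_conv_exp exp_add[symmetric])
    qed
    finally have "\<phi> (x * exp (w * v)) = of_real (F v) * \<Phi> v"
      by (simp add: \<phi>_def c_def \<Phi>_def F_def exp_minus field_simps del: of_real_mult)
    thus ?thesis by (simp add: f_def mult_ac)
  qed
  with integral_substitution_exp_tendsto[OF x w cont ai]
  have lim: "(\<lambda>K. integral {- real K - 1/2..real K - 1/2} (\<lambda>v. of_real (f v) * \<Phi> v)) \<longlonglongrightarrow> Gamma (1 + z) * c"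
    by (simp add: I)
  have G: "integral {-1/2..1/2} (\<lambda>v. of_real (G v) * cis (s * v)) = Gamma (1 + z) * c - \<Phi> (-1/2)"
  proof (rule integral_G[where C = "1 / \<bar>s\<bar>", OF _ _ \<Phi> _ lim])
    show "norm (\<Phi> v) \<le> 1 / \<bar>s\<bar> + \<bar>v\<bar>" for v
      by (simp add: \<Phi>_def norm_divide norm_mult)
  qed (auto intro!: continuous_intros simp: period)
  have "((\<lambda>v. of_real (v + ln x / w) * cis (s * v)) has_integral \<Phi> (-1/2)) {-1/2..1/2}"
  proof -
    \<comment> \<open>A primitive found by parts. Since \<Phi> agrees at both ends and the linear
      factor grows by 1, its increment is \<Phi> (-1/2).\<close>
    define \<Psi> where "\<Psi> = (\<lambda>v. complex_of_real (v + ln x / w) * \<Phi> v - \<Phi> v / (\<i> * of_real s))"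
    have d: "((\<lambda>v. complex_of_real (v + ln x / w)) has_vector_derivative of_real 1) (at v within A)" for v A
      by (rule has_vector_derivative_of_real) (auto intro!: derivative_eq_intros)
    have d2: "((\<lambda>v. \<Phi> v / (\<i> * of_real s)) has_vector_derivative \<Phi> v) (at v within A)" for v A
      using has_vector_derivative_mult_left[OF \<Phi>[of v A], of "1 / (\<i> * of_real s)"] by (simp add: \<Phi>_def)
    have "(\<Psi> has_vector_derivative of_real (v + ln x / w) * cis (s * v)) (at v within A)" for v A
      using has_vector_derivative_diff[OF has_vector_derivative_mult[OF d[of v A] \<Phi>[of v A]] d2[of v A]]
      by (simp add: \<Psi>_def)
    hence "((\<lambda>v. of_real (v + ln x / w) * cis (s * v)) has_integral (\<Psi> (1/2) - \<Psi> (-1/2))) {-1/2..1/2}"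
      by (intro fundamental_theorem_of_calculus) auto
    moreover have "\<Phi> (1/2) = \<Phi> (-1/2)" using cis_half by (simp add: \<Phi>_def)
    hence "\<Psi> (1/2) - \<Psi> (-1/2) = \<Phi> (-1/2)" by (simp add: \<Psi>_def algebra_simps)
    ultimately show ?thesis by simp
  qed
  hence A: "integral {-1/2..1/2} (\<lambda>v. of_real (v + ln x / w) * cis (s * v)) = \<Phi> (-1/2)"
    by (rule integral_unique)
  have "(\<lambda>v. P v * cis (s * v)) = (\<lambda>v. of_real (v + ln x / w) * cis (s * v) + of_real (G v) * cis (s * v))"
    by (simp add: P_def algebra_simps)
  moreover have "(\<lambda>v. complex_of_real (v + ln x / w) * cis (s * v)) integrable_on {-1/2..1/2}"
      "(\<lambda>v. complex_of_real (G v) * cis (s * v)) integrable_on {-1/2..1/2}"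
    using w by (intro integrable_continuous_interval continuous_intros continuous_G; simp)+
  ultimately have "integral {-1/2..1/2} (\<lambda>v. P v * cis (s * v)) =
      integral {-1/2..1/2} (\<lambda>v. of_real (v + ln x / w) * cis (s * v))
      + integral {-1/2..1/2} (\<lambda>v. of_real (G v) * cis (s * v))"
    by (simp only: integral_add)
  also have "\<dots> = Gamma (1 + z) * c" unfolding A G by simp
  also have "Gamma (1 + z) = z * Gamma z" using Gamma_plus1[OF ni] by (simp add: add.commute)
  also have "z * Gamma z * c = Gamma z * exp (- z * of_real (ln x)) / of_real w"
    using s w by (simp add: c_def z)
  finally show ?thesis unfolding s_def z_def .
qed

definition T :: "int \<Rightarrow> complex" where "T n = Gamma (\<rho> n) * exp (- \<rho> n * of_real (ln x))"

text \<open>The power of x has modulus 1, so the bound on Gamma at \<rho> n decides.\<close>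

lemma T_summable: "T summable_on (UNIV - {0})"
proof (rule abs_summable_summable, rule Infinite_Sum.abs_summable_on_comparison_test')
  show "(\<lambda>n::int. (w / (2 * pi))\<^sup>2 * (1 / (of_int n)\<^sup>2)) summable_on UNIV - {0}"
    by (intro summable_on_cmult_right inverse_square_summable_on_nonzero_int)
  fix n :: int assume n: "n \<in> UNIV - {0}"
  have "norm (exp (- \<rho> n * of_real (ln x))) = 1"
    by (simp add: norm_exp_eq_Re \<rho>_def)
  hence "norm (T n) = norm (Gamma (\<rho> n))" by (simp add: T_def norm_mult)
  also have "\<dots> \<le> 1 / (norm (\<rho> n))\<^sup>2"
    using n w by (intro norm_Gamma_imaginary_le) (auto simp: \<rho>_def)
  also have "\<dots> = (w / (2 * pi))\<^sup>2 * (1 / (of_int n)\<^sup>2)"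
    using w by (simp add: \<rho>_def norm_mult norm_divide power_divide power_mult_distrib)
  finally show "norm (T n) \<le> (w / (2 * pi))\<^sup>2 * (1 / (of_int n)\<^sup>2)" .
qed

text \<open>The symmetric Fourier sums tend to P 0, and by absolute summability also to the mean
  plus the unordered sum of the other coefficients; limits are unique.\<close>

lemma P_0_eq:
  "of_real (ln x / w + G 0) = of_real (1/2 - euler_mascheroni / w) + infsum T (UNIV - {0}) / of_real w"
proof -
  have d: "(P has_vector_derivative of_real (1 + (\<Sum>k. - f (0 + real k) - f (0 - real k - 1)))) (at 0)"
    unfolding P_def[abs_def]
    by (rule has_vector_derivative_of_real) (auto intro!: derivative_eq_intros G_deriv)
  have "continuous_on {-1/2..1/2} P"
    unfolding P_def[abs_def] using w by (intro continuous_intros continuous_G) auto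
  from fourier_symmetric_partial_sums_tendsto[OF this d]
  have 1: "(\<lambda>N. \<Sum>n = - int N..int N. integral {-1/2..1/2} (\<lambda>v. P v * cis (2 * pi * of_int n * v))) \<longlonglongrightarrow> P 0" .
  have 2: "(\<Sum>n = - int N..int N. integral {-1/2..1/2} (\<lambda>v. P v * cis (2 * pi * of_int n * v)))
      = of_real (1/2 - euler_mascheroni / w) + (\<Sum>n\<in>{- int N..int N} - {0}. T n) / of_real w" for N
  proof -
    have "(\<Sum>n = - int N..int N. integral {-1/2..1/2} (\<lambda>v. P v * cis (2 * pi * of_int n * v))) =
      integral {-1/2..1/2} P + (\<Sum>n\<in>{- int N..int N} - {0}. integral {-1/2..1/2} (\<lambda>v. P v * cis (2 * pi * of_int n * v)))"
      by (subst sum.remove[of _ 0]) auto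
    also have "(\<Sum>n\<in>{- int N..int N} - {0}. integral {-1/2..1/2} (\<lambda>v. P v * cis (2 * pi * of_int n * v)))
        = (\<Sum>n\<in>{- int N..int N} - {0}. T n / of_real w)"
      unfolding T_def by (intro sum.cong refl integral_P_cis) auto
    finally show ?thesis unfolding integral_P sum_divide_distrib .
  qed
  have "(\<lambda>N. of_real (1/2 - euler_mascheroni / w) + (\<Sum>n\<in>{- int N..int N} - {0}. T n) / of_real w)
      \<longlonglongrightarrow> of_real (1/2 - euler_mascheroni / w) + infsum T (UNIV - {0}) / of_real w"
    using w by (intro tendsto_intros has_sum_nonzero_int_symmetric_partial_sums has_sum_infsum T_summable) auto
  from LIMSEQ_unique[OF 1[unfolded 2] this] show ?thesis by (simp add: P_def)
qed

section \<open>The two real series of the theorem\<close>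

lemma summable_F: "summable (\<lambda>k. F (real k))"
proof (rule summable_comparison_test'[OF summable_geometric_w[of "1 / x"], where N = 0])
  fix k :: nat
  have e: "exp (- w) ^ k = exp (- (w * real k))"
    by (simp add: exp_of_nat_mult[symmetric] mult.commute)
  show "norm (F (real k)) \<le> 1 / x * exp (- w) ^ k"
    unfolding e using F_le[of "real k"] F_pos[of "real k"] by simp
qed

text \<open>With r = exp (- w), summing \<open>t\<close> over j gives the exponential series at - x
  r^(k+1), and summing over k a geometric series. Since r < 1, bounding r^((k+1)(j+1)) by r^(k+1)
  decouples the indices and permits the exchange.\<close>

lemma sums_one_minus_F:
  defines "b \<equiv> \<lambda>j. (-1) ^ (Suc j + 1) / fact (Suc j) * (x ^ Suc j / (exp (w * real (Suc j)) - 1))"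
  shows "summable b" "summable (\<lambda>k. 1 - F (- real k - 1))" "suminf b = (\<Sum>k. 1 - F (- real k - 1))"
proof -
  define r where "r = exp (- w)"
  have r: "0 < r" "r < 1" using w by (auto simp: r_def)
  define t where "t = (\<lambda>j k. (-1) ^ (Suc j + 1) / fact (Suc j) * x ^ Suc j * r ^ (Suc k * Suc j))"
  have le: "\<bar>t j k\<bar> \<le> (x ^ Suc j / fact (Suc j)) * r ^ Suc k" for j k
  proof -
    have "\<bar>t j k\<bar> = (x ^ Suc j / fact (Suc j)) * r ^ (Suc k * Suc j)"
      using x r by (simp add: t_def abs_mult power_abs)
    also have "\<dots> \<le> (x ^ Suc j / fact (Suc j)) * r ^ Suc k"
      using x r by (intro mult_left_mono power_decreasing) auto
    finally show ?thesis .
  qed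
  have a: "summable (\<lambda>j. x ^ Suc j / fact (Suc j))"
    using summable_exp[of x] by (subst summable_Suc_iff) (simp add: field_simps)
  have b: "summable (\<lambda>k. r ^ Suc k)"
    using r by (subst summable_Suc_iff) (auto intro: summable_geometric)
  have rows: "(\<lambda>k. t j k) sums b j" for j
  proof -
    \<comment> \<open>The ratio of the geometric series in k; y / (1 - y) is the factor 1 / (exp (w
      (j+1)) - 1) of the theorem.\<close>
    define y where "y = r ^ Suc j"
    have y: "0 < y" "y < 1" using r by (auto simp: y_def power_Suc_less_one simp del: power_Suc)
    have "(\<lambda>k. y * y ^ k) sums (y * (1 / (1 - y)))"
      using y by (intro sums_mult geometric_sums) auto
    hence series: "(\<lambda>k. ((-1) ^ (Suc j + 1) / fact (Suc j) * x ^ Suc j) * (y * y ^ k)) sums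
        ((-1) ^ (Suc j + 1) / fact (Suc j) * x ^ Suc j * (y * (1 / (1 - y))))"
      by (rule sums_mult)
    have pow: "y * y ^ k = r ^ (Suc k * Suc j)" for k
    proof -
      have "y * y ^ k = y ^ Suc k" by simp
      also have "\<dots> = r ^ (Suc k * Suc j)"
        unfolding y_def power_mult[symmetric] by (simp only: mult.commute)
      finally show ?thesis .
    qed
    have "y = exp (- (w * real (Suc j)))"
      unfolding y_def r_def by (simp only: exp_of_nat_mult[symmetric]) (simp add: mult.commute)
    hence "exp (w * real (Suc j)) = 1 / y" by (simp only: exp_minus inverse_eq_divide) simp
    hence geo: "y * (1 / (1 - y)) = 1 / (exp (w * real (Suc j)) - 1)"
      using y by (simp only:) (simp add: field_simps)
    show ?thesis using series[unfolded pow geo]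
      unfolding t_def b_def by (simp only: times_divide_eq_right mult_1_right mult.assoc)
  qed
  have cols: "(\<lambda>j. t j k) sums (1 - F (- real k - 1))" for k
  proof -
    define y where "y = - x * r ^ Suc k"
    have "(\<lambda>j. y ^ j /\<^sub>R fact j) sums exp y" by (rule exp_converges)
    hence "(\<lambda>j. y ^ Suc j /\<^sub>R fact (Suc j)) sums (exp y - 1)"
      by (subst sums_Suc_iff) simp
    hence "(\<lambda>j. - (y ^ Suc j /\<^sub>R fact (Suc j))) sums (- (exp y - 1))" by (rule sums_minus)
    moreover have "- (y ^ Suc j /\<^sub>R fact (Suc j)) = t j k" for j
    proof -
      have "y ^ Suc j = (-1) ^ Suc j * x ^ Suc j * r ^ (Suc k * Suc j)"
        unfolding y_def power_mult by (simp only: power_mult_distrib[symmetric]) simp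
      thus ?thesis unfolding t_def by (simp add: field_simps)
    qed
    moreover have "r ^ Suc k = exp (w * (- real k - 1))"
      unfolding r_def by (simp only: exp_of_nat_mult[symmetric]) (simp add: algebra_simps)
    hence "exp y = F (- real k - 1)" by (simp add: y_def F_def)
    ultimately show ?thesis by simp
  qed
  show "summable b" "summable (\<lambda>k. 1 - F (- real k - 1))" "suminf b = (\<Sum>k. 1 - F (- real k - 1))"
    using sums_swap_dominated[OF le a _ b _ rows cols] x r by simp_all
qed

lemma G_0: "G 0 = (\<Sum>k. F (real k)) - (\<Sum>k. 1 - F (- real k - 1))"
proof -
  have "G 0 = (\<Sum>k. F (real k) - (1 - F (- real k - 1)))"
    by (simp add: G_def q_def algebra_simps)
  thus ?thesis using suminf_diff[OF summable_F sums_one_minus_F(2)] by simp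
qed

end

theorem theorem1:
  fixes x w :: real
  assumes "x > 0" and "w > 0"
  shows "summable (\<lambda>k::nat. exp (- x * exp (w * real k))) \<and>
    summable (\<lambda>k::nat. (-1) ^ (Suc k + 1) / fact (Suc k)
            * (x ^ Suc k / (exp (w * real (Suc k)) - 1))) \<and>
    (\<lambda>k::int. Gamma (2 * of_real pi * \<i> * of_int k / of_real w)
            * exp (- (2 * of_real pi * \<i> * of_int k / of_real w) * of_real (ln x)))
          summable_on (UNIV - {0}) \<and>
    complex_of_real euler_mascheroni =
          of_real (w / 2 - ln x
            - w * (\<Sum>k::nat. exp (- x * exp (w * real k)))
            + w * (\<Sum>k::nat. (-1) ^ (Suc k + 1) / fact (Suc k)
                * (x ^ Suc k / (exp (w * real (Suc k)) - 1))))
          + (\<Sum>\<^sub>\<infinity>k::int\<in>UNIV - {0}. Gamma (2 * of_real pi * \<i> * of_int k / of_real w)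
              * exp (- (2 * of_real pi * \<i> * of_int k / of_real w) * of_real (ln x)))"
proof -
  interpret double_exponential x w using assms by unfold_locales
  define B where "B = (\<Sum>k::nat. (-1) ^ (Suc k + 1) / fact (Suc k)
                * (x ^ Suc k / (exp (w * real (Suc k)) - 1)))"
  define A where "A = (\<Sum>k::nat. exp (- x * exp (w * real k)))"
  define S where "S = infsum T (UNIV - {0})"
  have T: "T = (\<lambda>k::int. Gamma (2 * of_real pi * \<i> * of_int k / of_real w)
            * exp (- (2 * of_real pi * \<i> * of_int k / of_real w) * of_real (ln x)))"
    by (simp add: fun_eq_iff T_def \<rho>_def)
  have G: "G 0 = A - B"
    unfolding G_0 sums_one_minus_F(3)[symmetric] A_def B_def by (simp add: F_def)
  have "of_real w * of_real (ln x / w + G 0) = of_real w * (of_real (1/2 - euler_mascheroni / w) + S / of_real w :: complex)"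
    by (simp only: P_0_eq S_def)
  hence "complex_of_real (ln x + w * (A - B)) = of_real (w / 2 - euler_mascheroni) + S"
    using w by (simp add: G algebra_simps)
  hence eq: "complex_of_real euler_mascheroni = of_real (w / 2 - ln x - w * A + w * B) + S"
    by (simp add: algebra_simps)
  have sA: "summable (\<lambda>k::nat. exp (- x * exp (w * real k)))"
    using summable_F by (simp only: F_def)
  show ?thesis
    by (intro conjI sA sums_one_minus_F(1) T_summable[unfolded T] eq[unfolded S_def A_def B_def T])
qed

end
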